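(* Let $f:\mathbb{R}^n\to\mathbb{R}$, $x^0\in\mathbb{R}^n$, and $Y=\{x^0\}\cup\{x^0+d^i:i=1,\ldots,m\}\subseteq\mathbb{R}^n$. Suppose that $Y$ lies in the $d$-dimensional affine space $\mathcal{Y}=\{x^0+Q\widehat{x}:\widehat{x}\in\mathbb{R}^d\}$, where $d<n$ and $Q\in\mathbb{R}^{n\times d}$ has $d$ orthonormal columns, and that there exists a quadratic function that interpolates $f$ on $Y$. Let $\widehat{d}^i\in\mathbb{R}^d$ be such that $d^i=Q\widehat{d}^i$, let $\widehat{Y}=\{0\}\cup\{\widehat{d}^i:i=1,\ldots,m\}\subseteq\mathbb{R}^d$, and let $\widehat{f}(\widehat{x})=f(x^0+Q\widehat{x})$ for $\widehat{x}\in\mathbb{R}^d$. Then both $(\nabla_{\mathrm{MN}}f(x^0;Y),\nabla_{\mathrm{MN}}^2f(x^0;Y))$ and $(\nabla_{\mathrm{MN}}\widehat{f}(0;\widehat{Y}),\nabla_{\mathrm{MN}}^2\widehat{f}(0;\widehat{Y}))$ exist and are unique, and they satisfy $$\left(\nabla_{\mathrm{MN}}f(x^0;Y),\ \nabla_{\mathrm{MN}}^2f(x^0;Y)\right)=\left(Q\nabla_{\mathrm{MN}}\widehat{f}(0;\widehat{Y}),\ Q\nabla_{\mathrm{MN}}^2\widehat{f}(0;\widehat{Y})Q^\top\right).$$ Moreover, the corresponding minimum norm models satisfy $$m_{\mathrm{MN}}^{x^0,Y}(x)=\widehat{m}_{\mathrm{MN}}^{0,\widehat{Y}}(\widehat{x})\quad\text{for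 all }(x,\widehat{x})\in\mathbb{R}^n\times\mathbb{R}^d\text{ with }x\in(x^0+Q\widehat{x})+\mathrm{col}(Q)^\perp.$$
   Context: $S_k(\mathbb{R})$ is the set of real symmetric $k\times k$ matrices; $\|\cdot\|$ is the Euclidean norm and $\|\cdot\|_F$ the Frobenius norm; $\mathrm{col}(Q)^\perp$ is the orthogonal complement of the column space of $Q$. A quadratic function is a polynomial of degree at most 2. Minimum norm (MN) models. For a function $g:\mathbb{R}^k\to\mathbb{R}$, a point $z^0\in\mathbb{R}^k$ and a sample set $Z=\{z^0\}\cup\{z^0+u^i:i=1,\ldots,m\}\subseteq\mathbb{R}^k$, a pair $(\nabla_{\mathrm{MN}}g(z^0;Z),\nabla^2_{\mathrm{MN}}g(z^0;Z))$ is a minimizer of $$\min_{\alpha\in\mathbb{R}^k,\ H\in S_k(\mathbb{R})}\ \tfrac12\|\alpha\|^2+\tfrac12\|H\|_F^2\quad\text{s.t. }(u^i)^\top\alpha+\tfrac12(u^i)^\top Hu^i=g(z^0+u^i)-g(z^0),\ i=1,\ldots,m.$$ The corresponding MN model is $$m_{\mathrm{MN}}^{z^0,Z}(z)=g(z^0)+\nabla_{\mathrm{MN}}g(z^0;Z)^\top(z-z^0)+\tfrac12(z-z^0)^\top\nabla^2_{\mathrm{MN}}g(z^0;Z)(z-z^0).$$ In the claim, $m_{\mathrm{MN}}^{x^0,Y}$ is the model obtained with $k=n$, $g=f$, $z^0=x^0$, $Z=Y$, $u^i=d^i$ (full-space model), and $\widehat{m}_{\mathrm{MN}}^{0,\widehat{Y}}$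 is the model obtained with $k=d$, $g=\widehat{f}$, $z^0=0$, $Z=\widehat{Y}$, $u^i=\widehat{d}^i$ (subspace model). *)

theory Defs
  imports "HOL-Analysis.Analysis"
begin

definition quadratic_function :: "(real^'k \<Rightarrow> real) \<Rightarrow> bool" where
  "quadratic_function q \<longleftrightarrow>
     (\<exists>(c::real) (b::real^'k) (A::real^'k^'k).
        \<forall>x. q x = c + (\<Sum>i\<in>UNIV. b $ i * x $ i)
                    + (\<Sum>i\<in>UNIV. \<Sum>j\<in>UNIV. A $ i $ j * x $ i * x $ j))"

definition orthonormal_columns :: "real^'d^'n \<Rightarrow> bool" where
  "orthonormal_columns Q \<longleftrightarrow>
     (\<forall>i j. column i Q \<bullet> column j Q = (if i = j then 1 else 0))"

definition col_space :: "real^'d^'n \<Rightarrow> (real^'n) set" where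
  "col_space Q = span (columns Q)"

definition symmetric_matrices :: "(real^'k^'k) set" where
  "symmetric_matrices = {H. transpose H = H}"

text \<open>A sample set is given by its base point \<open>z0\<close> and displacements \<open>u 1, ..., u m\<close>;
  the values of \<open>u\<close> outside \<open>{1..m}\<close> are irrelevant.\<close>

definition sample_set :: "real^'k \<Rightarrow> nat \<Rightarrow> (nat \<Rightarrow> real^'k) \<Rightarrow> (real^'k) set" where
  "sample_set z0 m u = {z0} \<union> {z0 + u i | i. i \<in> {1..m}}"

text \<open>The norm of the type \<open>real^'k^'k\<close> is the Frobenius norm.\<close>

lemma norm_matrix_eq_frobenius:
  fixes H :: "real^'k^'l"
  shows "norm H = sqrt (\<Sum>i\<in>UNIV. \<Sum>j\<in>UNIV. (H $ i $ j)\<^sup>2)"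
  by (simp add: norm_vec_def L2_set_def sum_nonneg)

definition MN_objective :: "(real^'k) \<times> (real^'k^'k) \<Rightarrow> real" where
  "MN_objective = (\<lambda>(\<alpha>, H). 1/2 * (norm \<alpha>)\<^sup>2 + 1/2 * (norm H)\<^sup>2)"

definition MN_feasible ::
  "(real^'k \<Rightarrow> real) \<Rightarrow> real^'k \<Rightarrow> nat \<Rightarrow> (nat \<Rightarrow> real^'k) \<Rightarrow> (real^'k) \<times> (real^'k^'k) \<Rightarrow> bool" where
  "MN_feasible g z0 m u = (\<lambda>(\<alpha>, H). H \<in> symmetric_matrices \<and>
     (\<forall>i\<in>{1..m}. u i \<bullet> \<alpha> + 1/2 * (u i \<bullet> (H *v u i)) = g (z0 + u i) - g z0))"

definition is_MN_pair ::
  "(real^'k \<Rightarrow> real) \<Rightarrow> real^'k \<Rightarrow> nat \<Rightarrow> (nat \<Rightarrow> real^'k) \<Rightarrow> (real^'k) \<times> (real^'k^'k) \<Rightarrow> bool" where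
  "is_MN_pair g z0 m u = is_arg_min MN_objective (MN_feasible g z0 m u)"

text \<open>\<open>arg_min\<close> selects a minimizer; it is unspecified when there is none, so results about
  the following constants are meaningful only together with existence of an MN pair.\<close>

definition MN_grad ::
  "(real^'k \<Rightarrow> real) \<Rightarrow> real^'k \<Rightarrow> nat \<Rightarrow> (nat \<Rightarrow> real^'k) \<Rightarrow> real^'k" where
  "MN_grad g z0 m u = fst (arg_min MN_objective (MN_feasible g z0 m u))"

definition MN_hess ::
  "(real^'k \<Rightarrow> real) \<Rightarrow> real^'k \<Rightarrow> nat \<Rightarrow> (nat \<Rightarrow> real^'k) \<Rightarrow> real^'k^'k" where
  "MN_hess g z0 m u = snd (arg_min MN_objective (MN_feasible g z0 m u))"

definition MN_model ::
  "(real^'k \<Rightarrow> real) \<Rightarrow> real^'k \<Rightarrow> nat \<Rightarrow> (nat \<Rightarrow> real^'k) \<Rightarrow> real^'k \<Rightarrow> real" where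
  "MN_model g z0 m u z =
     g z0 + MN_grad g z0 m u \<bullet> (z - z0) + 1/2 * ((z - z0) \<bullet> (MN_hess g z0 m u *v (z - z0)))"

end

theory Submission
  imports Defs
begin

text \<open>
  On the product space the objective is half the squared norm, so an MN pair is the point of the
  closed convex feasible set that is closest to the origin; it exists uniquely once the feasible
  set is nonempty. The lift \<open>(a, K) \<mapsto> (Q a, Q K Q\<^sup>T)\<close> is an isometry from the subspace feasible
  set into the full one, and the pullback \<open>(\<alpha>, H) \<mapsto> (Q\<^sup>T \<alpha>, Q\<^sup>T H Q)\<close> maps back without increasing
  the norm. Hence the lift of the subspace minimizer is a minimizer in the full space.
\<close>

section \<open>Frobenius norm estimates and matrices with orthonormal columns\<close>

lemma inner_matrix_vector_mult_left:
  fixes A :: "real^'m^'n"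
  shows "(A *v x) \<bullet> y = x \<bullet> (transpose A *v y)"
  using dot_lmul_matrix[of y A x] by (simp add: inner_commute)

text \<open>A quadratic form does not distinguish \<open>A\<close> from \<open>transpose A\<close>.
  This supplies a symmetric Hessian for an arbitrary coefficient matrix; the factor 2 cancels the
  1/2 in the interpolation conditions.\<close>

lemma inner_symmetrization:
  fixes A :: "real^'n^'n"
  shows "u \<bullet> ((A + transpose A) *v u) = 2 * (u \<bullet> (A *v u))"
  using inner_matrix_vector_mult_left[of A u u] inner_commute[of u "A *v u"]
  by (simp add: matrix_vector_mult_add_rdistrib inner_add_right)

lemma norm_transpose:
  fixes M :: "real^'m^'n"
  shows "norm (transpose M) = norm M"
  unfolding norm_matrix_eq_frobenius transpose_def
  by (subst sum.swap) simp

lemma column_matrix_mult: "column j (A ** B) = A *v column j B"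
  by (simp add: column_def matrix_matrix_mult_def matrix_vector_mult_def vec_eq_iff)

lemma norm_matrix_columns:
  fixes M :: "real^'m^'n"
  shows "(norm M)\<^sup>2 = (\<Sum>j\<in>UNIV. (norm (column j M))\<^sup>2)"
proof -
  have "(norm M)\<^sup>2 = (norm (transpose M))\<^sup>2"
    by (simp add: norm_transpose)
  also have "\<dots> = (\<Sum>j\<in>UNIV. (norm (row j (transpose M)))\<^sup>2)"
    by (simp add: norm_vec_def L2_set_def sum_nonneg row_def)
  finally show ?thesis
    by simp
qed

text \<open>Left multiplication acts on each column separately and the squared Frobenius norm is the
  sum of the squared column norms, so a contraction of vectors also contracts matrices.\<close>

lemma norm_matrix_mult_le:
  fixes A :: "real^'m^'n" and B :: "real^'k^'m"
  assumes "\<And>x. norm (A *v x) \<le> norm x"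
  shows "norm (A ** B) \<le> norm B"
proof -
  have "(norm (A ** B))\<^sup>2 \<le> (norm B)\<^sup>2"
    unfolding norm_matrix_columns column_matrix_mult
    by (intro sum_mono power_mono assms) simp
  then show ?thesis
    by (rule power2_le_imp_le) simp
qed

lemma norm_matrix_mult_transpose_le:
  fixes A :: "real^'m^'n" and B :: "real^'m^'k"
  assumes "\<And>x. norm (A *v x) \<le> norm x"
  shows "norm (B ** transpose A) \<le> norm B"
  using norm_matrix_mult_le[OF assms, of "transpose B"] norm_transpose[of "B ** transpose A"]
  by (simp add: matrix_transpose_mul norm_transpose)

lemma norm_congruence_le:
  fixes A :: "real^'m^'n" and B :: "real^'m^'m"
  assumes "\<And>x. norm (A *v x) \<le> norm x"
  shows "norm (A ** B ** transpose A) \<le> norm B"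
  by (rule order_trans[OF norm_matrix_mult_transpose_le[OF assms] norm_matrix_mult_le[OF assms]])

lemma orthonormal_columns_transpose_mult:
  "orthonormal_columns Q \<Longrightarrow> transpose Q ** Q = mat 1"
  by (simp add: orthonormal_columns_def vec_eq_iff matrix_matrix_mult_def transpose_def mat_def
      column_def inner_vec_def)

lemma orthonormal_columns_norm:
  assumes "orthonormal_columns Q"
  shows "norm (Q *v x) = norm x"
  using orthonormal_columns_transpose_mult[OF assms]
  by (simp add: norm_eq_sqrt_inner inner_matrix_vector_mult_left matrix_vector_mul_assoc)

text \<open>Cauchy-Schwarz together with the isometry \<open>Q\<close> bounds the square of
  \<open>norm (transpose Q *v x)\<close> by \<open>norm x\<close> times itself; one factor then
  cancels unless it is zero.\<close>

lemma orthonormal_columns_norm_transpose: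
  fixes Q :: "real^'d^'n"
  assumes "orthonormal_columns Q"
  shows "norm (transpose Q *v x) \<le> norm x"
proof -
  have "norm (transpose Q *v x) * norm (transpose Q *v x) = x \<bullet> (Q *v (transpose Q *v x))"
    by (metis inner_matrix_vector_mult_left transpose_transpose power2_norm_eq_inner power2_eq_square)
  also have "\<dots> \<le> norm x * norm (transpose Q *v x)"
    by (metis norm_cauchy_schwarz orthonormal_columns_norm[OF assms])
  finally show ?thesis
    by (cases "transpose Q *v x = 0") auto
qed

section \<open>Existence and uniqueness of the MN pair\<close>

lemma MN_objective_norm: "MN_objective p = 1/2 * (norm p)\<^sup>2"
  by (cases p) (simp add: MN_objective_def norm_Pair algebra_simps)

lemma MN_objective_mono:
  "norm a \<le> norm b \<Longrightarrow> norm H \<le> norm K \<Longrightarrow> MN_objective (a, H) \<le> MN_objective (b, K)"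
  unfolding MN_objective_def by (auto intro!: add_mono power_mono)

lemma is_MN_pair_iff:
  "is_MN_pair g z0 m u p \<longleftrightarrow>
     MN_feasible g z0 m u p \<and> (\<forall>q. MN_feasible g z0 m u q \<longrightarrow> norm p \<le> norm q)"
  unfolding is_MN_pair_def is_arg_min_def MN_objective_norm
  by (auto simp: not_less)

text \<open>Symmetry and each interpolation condition are level sets of linear maps of the pair,
  which gives convexity and closedness of the feasible set together.\<close>

lemma MN_feasible_affine:
  "{p. MN_feasible g z0 m u p} =
     {p. transpose (snd p) - snd p = 0} \<inter>
     (\<Inter>i\<in>{1..m}. {p. u i \<bullet> fst p + 1/2 * (u i \<bullet> (snd p *v u i)) = g (z0 + u i) - g z0})"
  by (auto simp: MN_feasible_def symmetric_matrices_def)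

lemma linear_transpose_diff:
  "linear (\<lambda>p. transpose (snd p) - snd p :: real^'k^'k)"
  by (rule linearI) (auto simp: transpose_def vec_eq_iff algebra_simps)

lemma linear_quadratic_evaluation:
  fixes v :: "real^'k"
  shows "linear (\<lambda>p. v \<bullet> fst p + 1/2 * (v \<bullet> (snd p *v v)))"
  by (rule linearI)
    (simp_all add: inner_add_right matrix_vector_mult_add_rdistrib
      flip: scaleR_matrix_vector_assoc, simp_all add: algebra_simps)

lemma convex_closed_linear_level:
  fixes h :: "'a::euclidean_space \<Rightarrow> 'b::euclidean_space"
  assumes "linear h"
  shows "convex {p. h p = c}" "closed {p. h p = c}"
proof -
  have *: "{p. h p = c} = h -` {c}" by auto
  show "convex {p. h p = c}"
    unfolding * by (rule convex_linear_vimage[OF assms convex_singleton])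
  show "closed {p. h p = c}"
    unfolding *
    by (intro closed_vimage closed_singleton linear_continuous_on assms[THEN linear_conv_bounded_linear[THEN iffD1]])
qed

lemma MN_feasible_convex_closed:
  shows "convex {p. MN_feasible g z0 m u p}" "closed {p. MN_feasible g z0 m u p}"
  unfolding MN_feasible_affine
  by (rule convex_Int convex_INT closed_Int closed_INT ballI
      convex_closed_linear_level[OF linear_transpose_diff]
      convex_closed_linear_level[OF linear_quadratic_evaluation])+

lemma ex1_MN_pair:
  assumes "MN_feasible g z0 m u p0"
  shows "\<exists>!p. is_MN_pair g z0 m u p"
proof -
  let ?S = "{p. MN_feasible g z0 m u p}"
  have ne: "?S \<noteq> {}" using assms by blast
  obtain p where p: "p \<in> ?S" "\<And>q. q \<in> ?S \<Longrightarrow> dist 0 p \<le> dist 0 q"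
    using distance_attains_inf[OF MN_feasible_convex_closed(2) ne] by metis
  show ?thesis
  proof (rule ex1I)
    show "is_MN_pair g z0 m u p"
      using p by (simp add: is_MN_pair_iff)
    fix q assume "is_MN_pair g z0 m u q"
    then have "q \<in> ?S" "\<forall>z\<in>?S. dist 0 q \<le> dist 0 z"
      by (auto simp: is_MN_pair_iff)
    \<comment> \<open>Closedness gave a closest point to the origin; convexity makes it the only
      one.\<close>
    then show "q = p"
      using any_closest_point_unique[OF MN_feasible_convex_closed] p by blast
  qed
qed

lemma is_MN_pair_unique:
  assumes "is_MN_pair g z0 m u p" "is_MN_pair g z0 m u q"
  shows "p = q"
proof -
  have "MN_feasible g z0 m u p"
    using assms(1) by (simp only: is_MN_pair_iff)
  from ex1_MN_pair[OF this] show ?thesis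
    using assms by blast
qed

text \<open>A given minimizer \<open>p\<close> ensures that the choice made by
  \<open>arg_min\<close> is itself a minimizer, and uniqueness then identifies it with
  \<open>p\<close>.\<close>

lemma MN_grad_hess_eq:
  assumes "is_MN_pair g z0 m u p"
  shows "(MN_grad g z0 m u, MN_hess g z0 m u) = p"
proof -
  have "is_MN_pair g z0 m u (arg_min MN_objective (MN_feasible g z0 m u))"
    using assms unfolding is_MN_pair_def arg_min_def by (rule someI)
  then show ?thesis
    using is_MN_pair_unique[OF assms] by (simp add: MN_grad_def MN_hess_def)
qed

section \<open>Feasibility from a quadratic interpolant\<close>

lemma quadratic_function_alt:
  assumes "quadratic_function q"
  obtains c b A where "\<And>x. q x = c + b \<bullet> x + x \<bullet> (A *v x)"
proof -
  obtain c b A where q: "\<And>x. q x = c + (\<Sum>i\<in>UNIV. b $ i * x $ i)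
      + (\<Sum>i\<in>UNIV. \<Sum>j\<in>UNIV. A $ i $ j * x $ i * x $ j)"
    using assms unfolding quadratic_function_def by blast
  have "q x = c + b \<bullet> x + x \<bullet> (A *v x)" for x
    unfolding q by (simp add: inner_vec_def matrix_vector_mult_def sum_distrib_left algebra_simps)
  then show thesis by (rule that)
qed

text \<open>The gradient and Hessian of the interpolant at \<open>z0\<close> form a feasible pair,
  because the second-order Taylor expansion of a quadratic is exact. In terms of the coefficients
  they are \<open>b + (A + transpose A) *v z0\<close> and \<open>A + transpose A\<close>.\<close>

lemma MN_feasible_if_quadratic_interpolant:
  assumes "quadratic_function q" and "\<forall>y\<in>sample_set z0 m u. q y = g y"
  shows "\<exists>p. MN_feasible g z0 m u p"
proof -
  obtain c b A where q: "\<And>x. q x = c + b \<bullet> x + x \<bullet> (A *v x)"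
    using quadratic_function_alt[OF assms(1)] by metis
  have sym: "A + transpose A \<in> symmetric_matrices"
    by (simp add: symmetric_matrices_def transpose_def vec_eq_iff)
  have "v \<bullet> (b + (A + transpose A) *v z0) + 1/2 * (v \<bullet> ((A + transpose A) *v v))
      = q (z0 + v) - q z0" for v
  proof -
    \<comment> \<open>Of the two cross terms in the expansion of \<open>q (z0 + v)\<close>, this one
      yields the \<open>transpose A\<close> part of the gradient.\<close>
    have "z0 \<bullet> (A *v v) = v \<bullet> (transpose A *v z0)"
      by (metis inner_commute inner_matrix_vector_mult_left)
    then show ?thesis
      unfolding q inner_symmetrization
      by (simp add: inner_add_left inner_add_right matrix_vector_mult_add_rdistrib
          matrix_vector_right_distrib inner_commute[of b])
  qed
  moreover have "q (z0 + u i) - q z0 = g (z0 + u i) - g z0" if "i \<in> {1..m}" for i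
    using assms(2) that unfolding sample_set_def by auto
  ultimately have "MN_feasible g z0 m u (b + (A + transpose A) *v z0, A + transpose A)"
    using sym by (simp add: MN_feasible_def)
  then show ?thesis by blast
qed

section \<open>Transfer between the subspace and the full space\<close>

lemma MN_feasible_lift:
  fixes Q :: "real^'d^'n"
  assumes Q: "orthonormal_columns Q"
    and "MN_feasible (\<lambda>y. f (x0 + Q *v y)) 0 m v (a, K)"
    and "\<forall>i\<in>{1..m}. u i = Q *v v i"
  shows "MN_feasible f x0 m u (Q *v a, Q ** K ** transpose Q)"
proof -
  have QQ: "transpose Q *v (Q *v y) = y" for y
    using orthonormal_columns_transpose_mult[OF Q] by (simp add: matrix_vector_mul_assoc)
  have "transpose (Q ** K ** transpose Q) = Q ** K ** transpose Q" if "transpose K = K"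
    using that by (simp add: matrix_transpose_mul matrix_mul_assoc)
  then show ?thesis
    using assms(2,3)
    \<comment> \<open>Moving \<open>Q\<close> across the inner products creates the pattern that
      \<open>QQ\<close> cancels; \<open>transpose_matrix_vector\<close> would destroy it by
      rewriting to \<open>v*\<close>.\<close>
    by (simp add: MN_feasible_def symmetric_matrices_def inner_matrix_vector_mult_left
        QQ del: transpose_matrix_vector flip: matrix_vector_mul_assoc)
qed

text \<open>Since each \<open>u i\<close> is \<open>Q *v v i\<close>, the adjoint identity shows
  that the constraints see \<open>\<alpha>\<close> and \<open>H\<close> only through
  \<open>transpose Q *v \<alpha>\<close> and \<open>transpose Q ** H ** Q\<close>.\<close>

lemma MN_feasible_pullback:
  fixes Q :: "real^'d^'n"
  assumes "MN_feasible f x0 m u (\<alpha>, H)"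
    and "\<forall>i\<in>{1..m}. u i = Q *v v i"
  shows "MN_feasible (\<lambda>y. f (x0 + Q *v y)) 0 m v (transpose Q *v \<alpha>, transpose Q ** H ** Q)"
  using assms
  by (simp add: MN_feasible_def symmetric_matrices_def matrix_transpose_mul matrix_mul_assoc
      inner_matrix_vector_mult_left matrix_vector_mul_assoc)

lemma is_MN_pair_lift:
  fixes Q :: "real^'d^'n"
  assumes Q: "orthonormal_columns Q"
    and min: "is_MN_pair (\<lambda>y. f (x0 + Q *v y)) 0 m v (a, K)"
    and u: "\<forall>i\<in>{1..m}. u i = Q *v v i"
  shows "is_MN_pair f x0 m u (Q *v a, Q ** K ** transpose Q)"
  unfolding is_MN_pair_def is_arg_min_def
proof (intro conjI notI)
  show "MN_feasible f x0 m u (Q *v a, Q ** K ** transpose Q)"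
    using MN_feasible_lift[OF Q _ u] min by (simp add: is_MN_pair_iff)
  assume "\<exists>p. MN_feasible f x0 m u p \<and>
    MN_objective p < MN_objective (Q *v a, Q ** K ** transpose Q)"
  then obtain \<alpha> H where feas: "MN_feasible f x0 m u (\<alpha>, H)"
    and less: "MN_objective (\<alpha>, H) < MN_objective (Q *v a, Q ** K ** transpose Q)"
    by auto
  \<comment> \<open>A competitor in the full space is compared through its pullback: neither lifting
    nor pulling back increases the objective, and \<open>(a, K)\<close> is optimal in the
    subspace.\<close>
  have "MN_objective (Q *v a, Q ** K ** transpose Q) \<le> MN_objective (a, K)"
    by (intro MN_objective_mono norm_congruence_le) (simp_all add: orthonormal_columns_norm[OF Q])
  also have "\<dots> \<le> MN_objective (transpose Q *v \<alpha>, transpose Q ** H ** Q)"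
    using MN_feasible_pullback[OF feas u] min
    by (auto simp: is_MN_pair_def is_arg_min_def not_less)
  also have "\<dots> \<le> MN_objective (\<alpha>, H)"
    using norm_congruence_le[of "transpose Q" H] orthonormal_columns_norm_transpose[OF Q]
    by (intro MN_objective_mono) simp_all
  finally show False using less by simp
qed

text \<open>The entries of \<open>transpose Q *v w\<close> are the inner products of
  \<open>w\<close> with the columns of \<open>Q\<close>.\<close>

lemma transpose_mult_orthogonal_comp_col_space:
  fixes Q :: "real^'d^'n"
  assumes "w \<in> orthogonal_comp (col_space Q)"
  shows "transpose Q *v w = 0"
proof -
  have "column j Q \<bullet> w = 0" for j
    using assms span_base[of "column j Q" "columns Q"]
    by (auto simp: orthogonal_comp_def orthogonal_def col_space_def columns_def)
  then show ?thesis
    by (simp add: vec_eq_iff matrix_vector_mult_def transpose_def column_def inner_vec_def)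
qed

theorem theorem1:
  fixes f :: "real^'n \<Rightarrow> real"
    and x0 :: "real^'n"
    and m :: nat
    and u :: "nat \<Rightarrow> real^'n"
    and Q :: "real^'d^'n"
    and uh :: "nat \<Rightarrow> real^'d"
    and fh :: "real^'d \<Rightarrow> real"
  assumes "CARD('d) < CARD('n)"
    and "orthonormal_columns Q"
    and "sample_set x0 m u \<subseteq> {x0 + Q *v xh | xh. True}"
    and "\<exists>q. quadratic_function q \<and> (\<forall>y\<in>sample_set x0 m u. q y = f y)"
    and "\<forall>i\<in>{1..m}. u i = Q *v uh i"
    and "\<forall>xh. fh xh = f (x0 + Q *v xh)"
  shows "(\<exists>!p. is_MN_pair f x0 m u p) \<and>
         (\<exists>!p. is_MN_pair fh 0 m uh p) \<and>
         (MN_grad f x0 m u, MN_hess f x0 m u) =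
           (Q *v MN_grad fh 0 m uh, Q ** MN_hess fh 0 m uh ** transpose Q) \<and>
         (\<forall>x xh. x \<in> (\<lambda>w. (x0 + Q *v xh) + w) ` orthogonal_comp (col_space Q) \<longrightarrow>
            MN_model f x0 m u x = MN_model fh 0 m uh xh)"
proof -
  have fh: "fh = (\<lambda>y. f (x0 + Q *v y))"
    using assms(6) by auto
  obtain \<alpha> H where feas: "MN_feasible f x0 m u (\<alpha>, H)"
    using MN_feasible_if_quadratic_interpolant assms(4) by (metis surj_pair)
  have ex: "\<exists>!p. is_MN_pair f x0 m u p"
    by (rule ex1_MN_pair[OF feas])
  have exh: "\<exists>!p. is_MN_pair fh 0 m uh p"
    unfolding fh by (rule ex1_MN_pair[OF MN_feasible_pullback[OF feas assms(5)]])
  let ?a = "MN_grad fh 0 m uh" and ?K = "MN_hess fh 0 m uh"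
  have "is_MN_pair fh 0 m uh (?a, ?K)"
    using exh MN_grad_hess_eq by metis
  then have eq: "(MN_grad f x0 m u, MN_hess f x0 m u) = (Q *v ?a, Q ** ?K ** transpose Q)"
    using is_MN_pair_lift[OF assms(2) _ assms(5)] MN_grad_hess_eq unfolding fh by blast
  have "MN_model f x0 m u (x0 + Q *v xh + w) = MN_model fh 0 m uh xh"
    if w: "w \<in> orthogonal_comp (col_space Q)" for xh w
  proof -
    let ?s = "Q *v xh + w"
    \<comment> \<open>The lifted gradient and Hessian act on the displacement \<open>?s\<close> only
      through \<open>transpose Q *v ?s\<close>, from which the component \<open>w\<close>
      disappears.\<close>
    have s: "transpose Q *v ?s = xh"
      using orthonormal_columns_transpose_mult[OF assms(2)]
        transpose_mult_orthogonal_comp_col_space[OF w]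
      by (simp add: matrix_vector_right_distrib matrix_vector_mul_assoc)
    have "(Q *v ?a) \<bullet> ?s = ?a \<bullet> xh"
      by (simp only: inner_matrix_vector_mult_left s)
    moreover have "?s \<bullet> ((Q ** ?K ** transpose Q) *v ?s) = xh \<bullet> (?K *v xh)"
      by (metis inner_matrix_vector_mult_left inner_commute matrix_vector_mul_assoc s)
    moreover have "f x0 = fh 0"
      by (simp add: fh)
    moreover have "x0 + Q *v xh + w - x0 = ?s"
      by simp
    ultimately show ?thesis
      using eq unfolding MN_model_def by simp
  qed
  then show ?thesis
    using ex exh eq by blast
qed

end
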